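(* The polynomial $T_{\mathsf{M}}(x+1,x+1)$ does not have log-concave coefficients in general, and moreover is not unimodal in general. That is, there exists a matroid $\mathsf{M}$ such that the sequence of coefficients of the univariate polynomial $T_{\mathsf{M}}(x+1,x+1)$ is not log-concave, and there exists a matroid $\mathsf{M}$ such that this sequence is not unimodal.
   Context: For a matroid $\mathsf{M}$ on $E$ with rank function $\operatorname{rk}$, the Tutte polynomial is $T_{\mathsf{M}}(x,y)=\sum_{A\subseteq E}(x-1)^{\operatorname{rk}(E)-\operatorname{rk}(A)}(y-1)^{|A|-\operatorname{rk}(A)}$. A finite real sequence $(a_0,\dots,a_d)$ is unimodal if $a_0\le\dots\le a_m\ge\dots\ge a_d$ for some $m$, and log-concave if $a_i^2\ge a_{i-1}a_{i+1}$ for all $0<i<d$. *)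

theory Defs
  imports Complex_Main "HOL-Computational_Algebra.Polynomial"
begin

locale matroid =
  fixes E :: "'a set" and indep :: "'a set \<Rightarrow> bool"
  assumes finite_ground: "finite E"
    and indep_subset_ground: "indep X \<Longrightarrow> X \<subseteq> E"
    and indep_empty: "indep {}"
    and indep_subset: "indep X \<Longrightarrow> Y \<subseteq> X \<Longrightarrow> indep Y"
    and augmentation: "indep X \<Longrightarrow> indep Y \<Longrightarrow> card X < card Y \<Longrightarrow>
          \<exists>e\<in>Y - X. indep (insert e X)"

definition rk :: "('a set \<Rightarrow> bool) \<Rightarrow> 'a set \<Rightarrow> nat" where
  "rk indep A = Max (card ` {X. X \<subseteq> A \<and> indep X})"

(* An element of R[x][y]: the inner variable is x, the outer one is y. The natural-number
   subtractions do not truncate, since rk A \<le> rk E and rk A \<le> card A for A \<subseteq> E. *)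
definition tutte :: "'a set \<Rightarrow> ('a set \<Rightarrow> bool) \<Rightarrow> real poly poly" where
  "tutte E indep =
     (let x = [:[:0, 1:]:]; y = [:0, 1:] in
      \<Sum>A\<in>Pow E. (x - 1) ^ (rk indep E - rk indep A) * (y - 1) ^ (card A - rk indep A))"

(* The value p(u, v) of p \<in> R[x][y] at univariate polynomials u and v. *)
definition subst2 :: "real poly poly \<Rightarrow> real poly \<Rightarrow> real poly \<Rightarrow> real poly" where
  "subst2 p u v = poly (map_poly (\<lambda>q. pcompose q u) p) v"

definition tutte_diag :: "'a set \<Rightarrow> ('a set \<Rightarrow> bool) \<Rightarrow> real poly" where
  "tutte_diag E indep = subst2 (tutte E indep) [:1, 1:] [:1, 1:]"

(* The finite sequence (a 0, ..., a d); values of a beyond d are irrelevant. *)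
definition unimodal :: "(nat \<Rightarrow> real) \<Rightarrow> nat \<Rightarrow> bool" where
  "unimodal a d \<longleftrightarrow>
     (\<exists>m\<le>d. (\<forall>i<m. a i \<le> a (i + 1)) \<and> (\<forall>i. m \<le> i \<and> i < d \<longrightarrow> a i \<ge> a (i + 1)))"

definition log_concave :: "(nat \<Rightarrow> real) \<Rightarrow> nat \<Rightarrow> bool" where
  "log_concave a d \<longleftrightarrow> (\<forall>i. 0 < i \<and> i < d \<longrightarrow> (a i)\<^sup>2 \<ge> a (i - 1) * a (i + 1))"

end

theory Submission
  imports Defs "HOL-Number_Theory.Cong"
begin

text \<open>
  Since \<open>T(x + 1, x + 1)\<close> is the sum of \<open>x\<close> raised to corank plus nullity over all subsets, its
  coefficients for the uniform matroid \<open>U\<^bsub>k,n\<^esub>\<close> are \<open>(n choose k - j) + (n choose k + j)\<close> for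
  \<open>j > 0\<close>. When \<open>k\<close> lies about one standard deviation below \<open>n / 2\<close>, near the inflection point of the
  binomial distribution, these vary very little in \<open>j\<close>, and they can be taken slightly increasing.
  Turning a basis into a circuit-hyperplane raises its exponent from 0 to 2, so a sparse paving
  matroid with \<open>\<lambda>\<close> circuit-hyperplanes has its coefficient at 2 raised by \<open>\<lambda>\<close>, which creates a dip at 3.
  The \<open>k\<close>-subsets of \<open>{0..<n}\<close> whose sum lies in a fixed class modulo \<open>n\<close> never differ by a single
  exchange (Graham and Sloane), and for some class there are at least \<open>(n choose k) / n\<close> of them.
  The parameters \<open>n = 176\<close>, \<open>k = 81\<close> suffice.
\<close>

subsection \<open>The diagonal Tutte polynomial\<close>

lemma subst2_0 [simp]: "subst2 0 u v = 0"
  by (simp add: subst2_def)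

lemma subst2_pCons: "subst2 (pCons a p) u v = pcompose a u + v * subst2 p u v"
  by (simp add: subst2_def map_poly_pCons)

lemma subst2_add: "subst2 (p + q) u v = subst2 p u v + subst2 q u v"
  by (induction p q rule: poly_induct2) (simp_all add: subst2_pCons pcompose_add algebra_simps)

lemma subst2_smult: "subst2 (smult a p) u v = pcompose a u * subst2 p u v"
  by (induction p) (simp_all add: subst2_pCons pcompose_mult algebra_simps)

lemma subst2_mult: "subst2 (p * q) u v = subst2 p u v * subst2 q u v"
  by (induction p) (simp_all add: subst2_pCons subst2_add subst2_smult algebra_simps)

lemma subst2_1 [simp]: "subst2 1 u v = 1"
  by (simp add: subst2_pCons one_pCons)

lemma subst2_power: "subst2 (p ^ m) u v = subst2 p u v ^ m"
  by (induction m) (simp_all add: subst2_mult)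

lemma subst2_sum: "subst2 (\<Sum>i\<in>A. f i) u v = (\<Sum>i\<in>A. subst2 (f i) u v)"
  by (induction A rule: infinite_finite_induct) (simp_all add: subst2_add)

text \<open>Both \<open>x - 1\<close> and \<open>y - 1\<close> become the single variable, so each
  subset contributes one monomial.\<close>

lemma tutte_diag_eq:
  "tutte_diag E indep =
     (\<Sum>A\<in>Pow E. monom 1 ((rk indep E - rk indep A) + (card A - rk indep A)))"
proof -
  have x: "subst2 ([:[:0, 1:]:] - 1) [:1, 1:] [:1, 1:] = monom 1 1"
    by (simp add: subst2_pCons one_pCons pcompose_pCons monom_Suc)
  have y: "subst2 ([:0, 1:] - 1) [:1, 1:] [:1, 1:] = monom 1 1"
    by (simp add: subst2_pCons one_pCons pcompose_pCons monom_Suc)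
  show ?thesis
    by (simp add: tutte_diag_def tutte_def Let_def subst2_sum subst2_mult subst2_power x y
        monom_power mult_monom)
qed

lemma coeff_tutte_diag:
  assumes "finite E"
  shows "coeff (tutte_diag E indep) j =
    card {A \<in> Pow E. (rk indep E - rk indep A) + (card A - rk indep A) = j}"
  using assms by (simp add: tutte_diag_eq coeff_sum sum.If_cases Int_def)

subsection \<open>Sparse paving matroids\<close>

text \<open>\<open>H\<close> is to be the family of circuit-hyperplanes. By
  \<open>no_exchange\<close>, distinct members share fewer than \<open>k - 1\<close>
  elements.\<close>

locale sparse_paving =
  fixes E :: "'a set" and k :: nat and H :: "'a set set"
  assumes finite_ground: "finite E"
    and k_pos: "0 < k" and k_less: "k < card E"
    and hyperplane: "X \<in> H \<Longrightarrow> X \<subseteq> E \<and> card X = k"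
    and no_exchange: "e \<notin> X \<Longrightarrow> f \<notin> X \<Longrightarrow> insert e X \<in> H \<Longrightarrow> insert f X \<in> H \<Longrightarrow> e = f"
begin

definition indep :: "'a set \<Rightarrow> bool" where
  "indep X \<longleftrightarrow> X \<subseteq> E \<and> card X \<le> k \<and> X \<notin> H"

lemma matroid: "matroid E indep"
proof
  show "finite E" by (rule finite_ground)
  show "X \<subseteq> E" if "indep X" for X using that by (simp add: indep_def)
  show "indep {}" using hyperplane[of "{}"] k_pos by (auto simp: indep_def)
  show "indep Y" if X: "indep X" and YX: "Y \<subseteq> X" for X Y
  proof (cases "Y = X")
    case False
    then have "card Y < card X"
      using X YX finite_ground by (meson indep_def psubsetI psubset_card_mono rev_finite_subset)
    then show ?thesis using X YX hyperplane[of Y] by (auto simp: indep_def)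
  qed (use X in simp)
  show "\<exists>e\<in>Y - X. indep (insert e X)"
    if X: "indep X" and Y: "indep Y" and less: "card X < card Y" for X Y
  proof -
    have fin: "finite X" "finite Y"
      using X Y finite_ground by (auto simp: indep_def intro: rev_finite_subset)
    obtain e where e: "e \<in> Y - X"
      using less fin by (metis Diff_eq_empty_iff card_mono equals0I leD)
    have sub: "insert f X \<subseteq> E" "card (insert f X) \<le> k" if "f \<in> Y - X" for f
      using that X Y less fin by (auto simp: indep_def)
    show ?thesis
    \<comment> \<open>Of two candidates in \<open>Y - X\<close>, at most one leads into
      \<open>H\<close>; a sole candidate gives \<open>Y\<close> itself, which is
      independent.\<close>
    proof (cases "\<exists>f\<in>Y - X. f \<noteq> e")
      case True
      then obtain f where f: "f \<in> Y - X" "f \<noteq> e" by blast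
      then have "insert e X \<notin> H \<or> insert f X \<notin> H" using no_exchange e by blast
      then show ?thesis using e f sub by (auto simp: indep_def)
    next
      case False
      then have "Y \<subseteq> insert e X" by blast
      moreover have "card (insert e X) \<le> card Y" using less e fin by simp
      ultimately have "Y = insert e X" using fin by (simp add: card_seteq)
      then show ?thesis using e Y by blast
    qed
  qed
qed

lemma rk_eqI:
  assumes "X \<subseteq> A" "indep X" "card X = r" "\<And>Y. Y \<subseteq> A \<Longrightarrow> indep Y \<Longrightarrow> card Y \<le> r"
  shows "rk indep A = r"
proof -
  have "finite {X. X \<subseteq> A \<and> indep X}"
    by (rule finite_subset[of _ "Pow E"]) (auto simp: indep_def finite_ground)
  then show ?thesis
    unfolding rk_def using assms by (intro Max_eqI) auto
qed

lemma rk_hyperplane: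
  assumes "A \<in> H"
  shows "rk indep A = k - 1"
proof -
  have A: "A \<subseteq> E" "card A = k" and fin: "finite A"
    using hyperplane[OF assms] finite_ground finite_subset by auto
  then obtain e where e: "e \<in> A" using k_pos by fastforce
  show ?thesis
  proof (rule rk_eqI)
    show "indep (A - {e})"
      using A e fin k_pos hyperplane[of "A - {e}"] by (auto simp: indep_def)
    show "card Y \<le> k - 1" if "Y \<subseteq> A" "indep Y" for Y
    proof -
      have "Y \<subset> A" using that assms by (auto simp: indep_def)
      then have "card Y < k" using psubset_card_mono[OF fin] A(2) by metis
      then show ?thesis by simp
    qed
  qed (use A e fin in auto)
qed

lemma rk_nonhyperplane:
  assumes A: "A \<subseteq> E" "A \<notin> H"
  shows "rk indep A = min (card A) k"
proof -
  have fin: "finite A" using A finite_ground finite_subset by auto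
  have bound: "card Y \<le> min (card A) k" if "Y \<subseteq> A" "indep Y" for Y
    using that card_mono[OF fin] by (auto simp: indep_def)
  show ?thesis
  proof (cases "card A \<le> k")
    case True
    then show ?thesis
      using A bound by (intro rk_eqI[of A]) (auto simp: indep_def)
  next
    case False
    \<comment> \<open>At least two elements of \<open>A\<close> lie outside a subset
      \<open>X\<close> of size \<open>k - 1\<close>, so one of them extends \<open>X\<close> without
      landing in \<open>H\<close>.\<close>
    then have "k - 1 \<le> card A" by simp
    then obtain X where X: "X \<subseteq> A" "card X = k - 1" "finite X"
      by (rule obtain_subset_with_card_n)
    then have "card (A - X) \<ge> 2"
      using False fin k_pos by (simp add: card_Diff_subset)
    then obtain e f where ef: "e \<in> A - X" "f \<in> A - X" "e \<noteq> f"
      by (auto simp: numeral_2_eq_2 card_le_Suc_iff)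
    then have "insert e X \<notin> H \<or> insert f X \<notin> H" using no_exchange by blast
    then obtain g where g: "g \<in> A - X" "insert g X \<notin> H" using ef by blast
    show ?thesis
      using A X g bound False k_pos by (intro rk_eqI[of "insert g X"]) (auto simp: indep_def)
  qed
qed

text \<open>Members of \<open>H\<close> have corank 1 and nullity 1. For all other sets the exponent
  is the distance from \<open>card A\<close> to \<open>k\<close>, written with truncated
  subtraction.\<close>

lemma corank_plus_nullity:
  assumes "A \<subseteq> E"
  shows "(rk indep E - rk indep A) + (card A - rk indep A) =
    (if A \<in> H then 2 else (k - card A) + (card A - k))"
proof -
  have "rk indep E = k" using rk_nonhyperplane[of E] hyperplane[of E] k_less by auto
  then show ?thesis
    using assms k_pos hyperplane[of A] by (auto simp: rk_hyperplane rk_nonhyperplane)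
qed

text \<open>\<open>0 < j\<close> keeps the levels \<open>k - j\<close> and \<open>k + j\<close>
  distinct from each other and from level \<open>k\<close>; \<open>j \<le> k\<close> prevents
  truncation in \<open>k - j\<close>.\<close>

lemma coeff_tutte_diag:
  assumes j: "0 < j" "j \<le> k"
  shows "coeff (tutte_diag E indep) j =
    real ((card E choose (k - j)) + (card E choose (k + j)) + (if j = 2 then card H else 0))"
proof -
  let ?L = "{A. A \<subseteq> E \<and> card A = k - j}" and ?U = "{A. A \<subseteq> E \<and> card A = k + j}"
  let ?H = "if j = 2 then H else {}"
  let ?W = "{A \<in> Pow E. (rk indep E - rk indep A) + (card A - rk indep A) = j}"
  have "?W = {A \<in> Pow E. (if A \<in> H then 2 else (k - card A) + (card A - k)) = j}"
    by (intro Collect_cong conj_cong refl) (simp only: Pow_iff corank_plus_nullity)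
  also have "\<dots> = ?L \<union> ?U \<union> ?H"
    using j hyperplane by (auto split: if_splits)
  finally have "?W = ?L \<union> ?U \<union> ?H" .
  moreover have "finite (Pow E)" "?L \<subseteq> Pow E" "?U \<subseteq> Pow E" "?H \<subseteq> Pow E"
    using finite_ground hyperplane by auto
  then have "finite ?L" "finite ?U" "finite ?H" by (meson finite_subset)+
  moreover have "?L \<inter> ?U = {}" "(?L \<union> ?U) \<inter> ?H = {}" using j hyperplane by auto
  ultimately show ?thesis
    by (simp add: Submission.coeff_tutte_diag finite_ground card_Un_disjoint n_subsets)
qed

end

subsection \<open>Subsets with prescribed sum modulo \<open>n\<close>\<close>

definition residue_subsets :: "nat \<Rightarrow> nat \<Rightarrow> nat \<Rightarrow> nat set set" where
  "residue_subsets n k c = {A. A \<subseteq> {0..<n} \<and> card A = k \<and> \<Sum>A mod n = c}"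

text \<open>Equal sums modulo \<open>n\<close> make the two added elements congruent; both are below
  \<open>n\<close>, hence equal.\<close>

lemma sparse_paving_residue_subsets:
  assumes "0 < k" "k < n"
  shows "sparse_paving {0..<n} k (residue_subsets n k c)"
proof
  fix e f :: nat and X
  assume X: "e \<notin> X" "f \<notin> X" and e: "insert e X \<in> residue_subsets n k c"
    and f: "insert f X \<in> residue_subsets n k c"
  have "finite X" using e by (auto simp: residue_subsets_def intro: finite_subset)
  then have "[\<Sum>X + e = \<Sum>X + f] (mod n)"
    using X e f by (simp add: residue_subsets_def cong_def add.commute)
  then show "e = f"
    using e f by (simp add: residue_subsets_def cong_add_lcancel_nat cong_less_modulus_unique_nat)
qed (use assms in \<open>auto simp: residue_subsets_def\<close>)

text \<open>Pigeonhole: the \<open>n\<close> residue classes cover all \<open>k\<close>-subsets, so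
  some class reaches the average size.\<close>

lemma many_residue_subsets:
  assumes "0 < n"
  obtains c where "n choose k \<le> n * card (residue_subsets n k c)"
proof -
  have "{A. A \<subseteq> {0..<n} \<and> card A = k} = (\<Union>c\<in>{0..<n}. residue_subsets n k c)"
    using assms by (auto simp: residue_subsets_def)
  then have le: "n choose k \<le> (\<Sum>c\<in>{0..<n}. card (residue_subsets n k c))"
    using n_subsets[of "{0..<n}" k] card_UN_le[of "{0..<n}" "residue_subsets n k"] by simp
  have "\<exists>c. n choose k \<le> n * card (residue_subsets n k c)"
  proof (rule ccontr)
    assume "\<nexists>c. n choose k \<le> n * card (residue_subsets n k c)"
    then have "(\<Sum>c\<in>{0..<n}. n * card (residue_subsets n k c)) < (\<Sum>c\<in>{0..<n}. n choose k)"
      using assms by (intro sum_strict_mono) (auto simp: not_le)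
    then show False
      using le by (simp flip: sum_distrib_left)
  qed
  then show thesis using that by blast
qed

subsection \<open>The counterexample\<close>

lemma Suc_times_binomial_Suc: "Suc j * (n choose Suc j) = (n - j) * (n choose j)"
  by (simp only: binomial_absorption binomial_absorb_comp)

text \<open>The index pairs are 81 plus or minus 2, 3 and 4, and \<open>h\<close> stands for the
  number of circuit-hyperplanes. Consecutive ratios make every \<open>B j\<close> involved a
  multiple of \<open>B 77\<close>, so only linear arithmetic remains.\<close>

lemma binomials_176_81:
  fixes h :: real
  assumes "real (176 choose 81) \<le> 176 * h"
  defines "B \<equiv> \<lambda>j. real (176 choose j)"
  shows "B 84 + B 78 < B 83 + B 79 + h" and "B 84 + B 78 < B 85 + B 77" and "0 < B 85"
proof -
  have step: "real (Suc j) * B (Suc j) = real (176 - j) * B j" for j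
    unfolding B_def by (simp only: Suc_times_binomial_Suc flip: of_nat_mult)
  have ratios: "78 * B 78 = 99 * B 77" "79 * B 79 = 98 * B 78" "80 * B 80 = 97 * B 79"
    "81 * B 81 = 96 * B 80" "82 * B 82 = 95 * B 81" "83 * B 83 = 94 * B 82"
    "84 * B 84 = 93 * B 83" "85 * B 85 = 92 * B 84"
    using step[of 77] step[of 78] step[of 79] step[of 80] step[of 81] step[of 82] step[of 83]
      step[of 84]
    by simp_all
  have pos: "0 < B 77" by (simp add: B_def)
  have h: "B 81 \<le> 176 * h" using assms by simp
  show "B 84 + B 78 < B 83 + B 79 + h" using ratios pos h by linarith
  show "B 84 + B 78 < B 85 + B 77" using ratios pos by linarith
  show "0 < B 85" using ratios pos by linarith
qed

theorem corollary7p22: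
  "(\<exists>(E :: nat set) indep. matroid E indep \<and>
      \<not> log_concave (coeff (tutte_diag E indep)) (degree (tutte_diag E indep))) \<and>
   (\<exists>(E :: nat set) indep. matroid E indep \<and>
      \<not> unimodal (coeff (tutte_diag E indep)) (degree (tutte_diag E indep)))"
proof -
  obtain c where c: "176 choose 81 \<le> 176 * card (residue_subsets 176 81 c)"
    using many_residue_subsets[of 176 81] by auto
  interpret sparse_paving "{0..<176}" 81 "residue_subsets 176 81 c"
    by (rule sparse_paving_residue_subsets) auto
  define a where "a = coeff (tutte_diag {0..<176} indep)"
  define d where "d = degree (tutte_diag {0..<176} indep)"
  have "real (176 choose 81) \<le> 176 * real (card (residue_subsets 176 81 c))"
    using c by (metis of_nat_le_iff of_nat_mult of_nat_numeral)
  note bounds = binomials_176_81[OF this]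
  have a3: "a 3 < a 2" "a 3 < a 4" "0 \<le> a 3" "0 < a 4"
    using bounds by (simp_all add: a_def coeff_tutte_diag)
  \<comment> \<open>The nonzero coefficient at 4 makes 3 an interior index.\<close>
  then have d: "3 < d"
    using le_degree[of "tutte_diag {0..<176} indep" 4] by (simp add: a_def d_def)
  have "(a 3)\<^sup>2 < a 2 * a 4"
    unfolding power2_eq_square using a3 by (intro mult_strict_mono) auto
  then have "\<not> log_concave a d"
    using d unfolding log_concave_def by (auto intro!: exI[of _ 3])
  moreover have "\<not> unimodal a d"
  proof
    assume "unimodal a d"
    then obtain m where m: "\<forall>i<m. a i \<le> a (i + 1)" "\<forall>i. m \<le> i \<and> i < d \<longrightarrow> a i \<ge> a (i + 1)"
      unfolding unimodal_def by blast
    \<comment> \<open>A peak at 3 or later would force \<open>a 2 \<le> a 3\<close>, an earlier one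
      \<open>a 4 \<le> a 3\<close>.\<close>
    then show False
      using a3 d m(1)[rule_format, of 2] m(2)[rule_format, of 3] by (cases "3 \<le> m") auto
  qed
  ultimately show ?thesis
    using matroid unfolding a_def d_def by blast
qed

end
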